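(* Let $e\ge 4$, $q\ge 1$, $d\ge 1$ be integers, put $m=e+2q+1$ and assume $\gcd(m,d)=1$. Let $\Gamma=\Gamma_{(e,q,d)}(\mathcal S)$ be the numerical semigroup generated by $\mathcal S=\{m,\;m+d\}\cup\{(q+1)m+(q+i)d\mid 2\le i\le e-1\}$. Then the Hilbert function $H_{\Gamma}$ is non-decreasing, i.e. $H_\Gamma(n)\le H_\Gamma(n+1)$ for all $n\ge 0$.
   Context: Fix a field $K$. For a numerical semigroup $\Gamma$ generated by $a_1<\dots<a_e$, let $R=K[[t^{a_1},\dots,t^{a_e}]]\subset K[[t]]$ with maximal ideal $\mathfrak m=(t^{a_1},\dots,t^{a_e})$. The Hilbert function of $\Gamma$ is $H_\Gamma(n)=\dim_K(\mathfrak m^n/\mathfrak m^{n+1})$, $n\ge 0$. Equivalently, for $n\ge 1$, $H_\Gamma(n)=\#(nM\setminus (n+1)M)$ where $M=\Gamma\setminus\{0\}$ and $nM=M+\dots+M$ ($n$ copies), and $H_\Gamma(0)=1$. *)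

theory Defs
  imports
    "HOL-Computational_Algebra.Formal_Power_Series"
    "HOL-Algebra.QuotRing"
    "HOL-Algebra.Ideal_Product"
    "HOL-Algebra.Embedded_Algebras"
begin

text \<open>Throughout, a semigroup \<open>\<Gamma>\<close> is presented by a finite set \<open>S\<close> of positive generators
  (not necessarily minimal).\<close>

definition generated_semigroup :: "nat set \<Rightarrow> nat set" where
  "generated_semigroup S = {n. \<exists>\<alpha> :: nat \<Rightarrow> nat. n = (\<Sum>s\<in>S. \<alpha> s * s)}"

text \<open>The exponent vectors \<open>\<alpha>\<close> of the monomials \<open>x\<^sup>\<alpha>\<close> in variables \<open>x\<^sub>s\<close>, \<open>s \<in> S\<close>, that the
  substitution \<open>x\<^sub>s \<mapsto> t\<^sup>s\<close> sends to \<open>t\<^sup>n\<close>.\<close>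

definition exponent_vectors :: "nat set \<Rightarrow> nat \<Rightarrow> (nat \<Rightarrow> nat) set" where
  "exponent_vectors S n = {\<alpha>. (\<forall>s. s \<notin> S \<longrightarrow> \<alpha> s = 0) \<and> (\<Sum>s\<in>S. \<alpha> s * s) = n}"

text \<open>\<open>K[[t\<^sup>s | s \<in> S]]\<close>: the image in \<open>K[[t]]\<close> of the power series
  \<open>\<Sum>\<^sub>\<alpha> c\<^sub>\<alpha> x\<^sup>\<alpha>\<close> under \<open>x\<^sub>s \<mapsto> t\<^sup>s\<close>. Each \<open>exponent_vectors S n\<close> is finite, because the elements
  of \<open>S\<close> are positive.\<close>

definition semigroup_ring :: "nat set \<Rightarrow> ('k::field) fps ring" where
  "semigroup_ring S =
    \<lparr> carrier = {f. \<exists>c :: (nat \<Rightarrow> nat) \<Rightarrow> 'k. \<forall>n. fps_nth f n = (\<Sum>\<alpha>\<in>exponent_vectors S n. c \<alpha>)},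
      mult = (*), one = 1, zero = 0, add = (+) \<rparr>"

definition max_ideal :: "nat set \<Rightarrow> ('k::field) fps set" where
  "max_ideal S = Idl\<^bsub>semigroup_ring S\<^esub> ((\<lambda>s. fps_X ^ s) ` S)"

text \<open>The power \<open>\<mm>\<^sup>n\<close>, taken in the monoid of ideals under ideal multiplication; in particular
  \<open>\<mm>\<^sup>0\<close> is the whole ring.\<close>

definition max_ideal_power :: "nat set \<Rightarrow> nat \<Rightarrow> ('k::field) fps set" where
  "max_ideal_power S n = max_ideal S [^]\<^bsub>ideals_set (semigroup_ring S)\<^esub> n"

text \<open>\<open>dim\<^sub>K (\<mm>\<^sup>n / \<mm>\<^sup>n\<^sup>+\<^sup>1)\<close>. The quotient is viewed as the image of \<open>\<mm>\<^sup>n\<close> in the ring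
  \<open>R / \<mm>\<^sup>n\<^sup>+\<^sup>1\<close>, in which \<open>K\<close> is embedded as the subfield of classes of constant series. The type
  argument carries the field \<open>K\<close>.\<close>

definition hilbert_function :: "'k::field itself \<Rightarrow> nat set \<Rightarrow> nat \<Rightarrow> nat" where
  "hilbert_function _ S n =
    (let R = (semigroup_ring S :: 'k fps ring);
         I = max_ideal_power S (Suc n);
         cls = (\<lambda>f. I +>\<^bsub>R\<^esub> f)
     in ring.dim (R Quot I) (cls ` range fps_const) (cls ` max_ideal_power S n))"


subsection \<open>Independence of the choice of generators\<close>

text \<open>The ring consists of the series with support in \<open>\<Gamma>\<close>, and the ideal of those among them without
  constant term. Hence the Hilbert function depends on \<open>S\<close> only through \<open>\<Gamma>\<close>.\<close>

lemma exponent_vectors_nonempty_iff: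
  "exponent_vectors S n \<noteq> {} \<longleftrightarrow> n \<in> generated_semigroup S"
proof
  assume "exponent_vectors S n \<noteq> {}"
  then show "n \<in> generated_semigroup S"
    by (auto simp: exponent_vectors_def generated_semigroup_def)
next
  assume "n \<in> generated_semigroup S"
  then obtain \<alpha> :: "nat \<Rightarrow> nat" where \<alpha>: "n = (\<Sum>s\<in>S. \<alpha> s * s)"
    by (auto simp: generated_semigroup_def)
  have "(\<lambda>s. if s \<in> S then \<alpha> s else 0) \<in> exponent_vectors S n"
    unfolding exponent_vectors_def using \<alpha> by (auto intro!: sum.cong)
  then show "exponent_vectors S n \<noteq> {}" by blast
qed

lemma finite_exponent_vectors:
  assumes "finite S" "0 \<notin> S"
  shows "finite (exponent_vectors S n)"
proof (rule finite_subset)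
  show "finite {\<alpha>. \<alpha> ` S \<subseteq> {..n} \<and> (\<forall>s. s \<notin> S \<longrightarrow> \<alpha> s = 0)}"
    by (rule finite_subset[OF _ finite_set_of_finite_funs[OF assms(1), of "{..n}" 0]]) auto
  show "exponent_vectors S n \<subseteq> {\<alpha>. \<alpha> ` S \<subseteq> {..n} \<and> (\<forall>s. s \<notin> S \<longrightarrow> \<alpha> s = 0)}"
  proof safe
    fix \<alpha> s assume \<alpha>: "\<alpha> \<in> exponent_vectors S n" and s: "s \<in> S"
    have "\<alpha> s * 1 \<le> \<alpha> s * s"
      using s assms(2) by (intro mult_le_mono) (auto simp: Suc_le_eq intro: gr0I)
    also have "\<dots> \<le> (\<Sum>s\<in>S. \<alpha> s * s)"
      using s assms(1) by (intro member_le_sum) auto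
    also have "\<dots> = n" using \<alpha> by (simp add: exponent_vectors_def)
    finally show "\<alpha> s \<le> n" by simp
  qed (auto simp: exponent_vectors_def)
qed

lemma carrier_semigroup_ring:
  assumes "finite S" "0 \<notin> S"
  shows "carrier (semigroup_ring S :: 'k::field fps ring) =
    {f. \<forall>n. fps_nth f n \<noteq> 0 \<longrightarrow> n \<in> generated_semigroup S}"
proof safe
  fix f :: "'k fps" and n
  assume "f \<in> carrier (semigroup_ring S)" "fps_nth f n \<noteq> 0"
  then have "exponent_vectors S n \<noteq> {}"
    by (auto simp: semigroup_ring_def)
  then show "n \<in> generated_semigroup S"
    by (simp add: exponent_vectors_nonempty_iff)
next
  fix f :: "'k fps"
  assume f: "\<forall>n. fps_nth f n \<noteq> 0 \<longrightarrow> n \<in> generated_semigroup S"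
  define w where "w \<alpha> = (\<Sum>s\<in>S. \<alpha> s * s)" for \<alpha> :: "nat \<Rightarrow> nat"
  define r where "r n = (SOME \<alpha>. \<alpha> \<in> exponent_vectors S n)" for n
  define c where "c \<alpha> = (if \<alpha> = r (w \<alpha>) then fps_nth f (w \<alpha>) else 0)" for \<alpha>
  have "fps_nth f n = (\<Sum>\<alpha>\<in>exponent_vectors S n. c \<alpha>)" for n
  proof (cases "n \<in> generated_semigroup S")
    case True
    then have r: "r n \<in> exponent_vectors S n"
      unfolding r_def by (metis exponent_vectors_nonempty_iff ex_in_conv someI_ex)
    have "(\<Sum>\<alpha>\<in>exponent_vectors S n. c \<alpha>) =
        (\<Sum>\<alpha>\<in>exponent_vectors S n. if \<alpha> = r n then fps_nth f n else 0)"
      by (rule sum.cong) (auto simp: c_def w_def exponent_vectors_def)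
    also have "\<dots> = fps_nth f n"
      using r finite_exponent_vectors[OF assms] by simp
    finally show ?thesis by simp
  next
    case False
    then have "exponent_vectors S n = {}" "fps_nth f n = 0"
      using f exponent_vectors_nonempty_iff by auto
    then show ?thesis by simp
  qed
  then show "f \<in> carrier (semigroup_ring S)"
    by (auto simp: semigroup_ring_def)
qed

lemma generated_semigroup_0: "0 \<in> generated_semigroup S"
  unfolding generated_semigroup_def by (rule CollectI, rule exI[of _ "\<lambda>_. 0"]) simp

lemma generated_semigroup_add:
  assumes "a \<in> generated_semigroup S" "b \<in> generated_semigroup S"
  shows "a + b \<in> generated_semigroup S"
proof -
  obtain \<alpha> \<beta> :: "nat \<Rightarrow> nat"
    where "a = (\<Sum>s\<in>S. \<alpha> s * s)" "b = (\<Sum>s\<in>S. \<beta> s * s)"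
    using assms unfolding generated_semigroup_def by blast
  then have "a + b = (\<Sum>s\<in>S. (\<alpha> s + \<beta> s) * s)"
    by (simp add: sum.distrib distrib_right)
  then show ?thesis
    unfolding generated_semigroup_def by (intro CollectI exI[of _ "\<lambda>s. \<alpha> s + \<beta> s"])
qed

lemma generator_in_generated_semigroup:
  assumes "finite S" "s \<in> S"
  shows "s \<in> generated_semigroup S"
  unfolding generated_semigroup_def
proof (intro CollectI exI)
  have "(\<Sum>x\<in>S. (if x = s then 1 else 0) * x) = (\<Sum>x\<in>S. if x = s then x else 0)"
    by (rule sum.cong) auto
  also have "\<dots> = s" using assms by simp
  finally show "s = (\<Sum>x\<in>S. (if x = s then 1 else 0) * x)" by simp
qed

lemma generated_semigroup_peel:
  assumes "finite S" "n \<in> generated_semigroup S" "n \<noteq> 0"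
  obtains s where "s \<in> S" "s \<le> n" "n - s \<in> generated_semigroup S"
proof -
  obtain \<alpha> :: "nat \<Rightarrow> nat" where \<alpha>: "n = (\<Sum>s\<in>S. \<alpha> s * s)"
    using assms(2) unfolding generated_semigroup_def by blast
  then have "\<exists>s\<in>S. \<alpha> s * s \<noteq> 0"
    using assms(3) sum.neutral[of S "\<lambda>s. \<alpha> s * s"] by metis
  then obtain s where s: "s \<in> S" "\<alpha> s * s \<noteq> 0" by blast
  have "n = \<alpha> s * s + (\<Sum>x\<in>S - {s}. \<alpha> x * x)"
    using \<alpha> sum.remove[OF assms(1) s(1), of "\<lambda>x. \<alpha> x * x"] by simp
  also have "\<alpha> s * s = s + (\<alpha> s - 1) * s"
    using s by (cases "\<alpha> s") auto
  also have "(\<Sum>x\<in>S - {s}. \<alpha> x * x) = (\<Sum>x\<in>S - {s}. (\<alpha>(s := \<alpha> s - 1)) x * x)"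
    by (rule sum.cong) auto
  also have "s + (\<alpha> s - 1) * s + \<dots> = s + (\<Sum>x\<in>S. (\<alpha>(s := \<alpha> s - 1)) x * x)"
    using sum.remove[OF assms(1) s(1), of "\<lambda>x. (\<alpha>(s := \<alpha> s - 1)) x * x"] by simp
  finally have n: "n = s + (\<Sum>x\<in>S. (\<alpha>(s := \<alpha> s - 1)) x * x)" .
  show ?thesis
  proof
    show "s \<in> S" by fact
    show "s \<le> n" using n by linarith
    have "n - s = (\<Sum>x\<in>S. (\<alpha>(s := \<alpha> s - 1)) x * x)" using n by linarith
    then show "n - s \<in> generated_semigroup S" unfolding generated_semigroup_def by blast
  qed
qed

lemma semigroup_ring_simps [simp]:
  "mult (semigroup_ring S) = (*)" "one (semigroup_ring S) = 1"
  "zero (semigroup_ring S) = 0" "add (semigroup_ring S) = (+)"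
  by (simp_all add: semigroup_ring_def)

lemma cring_semigroup_ring:
  assumes "finite S" "0 \<notin> S"
  shows "cring (semigroup_ring S :: 'k::field fps ring)"
proof (intro cringI abelian_groupI comm_monoidI)
  note C = carrier_semigroup_ring[OF assms]
  let ?R = "semigroup_ring S :: 'k fps ring"
  show "x \<oplus>\<^bsub>?R\<^esub> y \<in> carrier ?R" if "x \<in> carrier ?R" "y \<in> carrier ?R" for x y
    using that unfolding C by (auto, metis add.right_neutral)
  show "\<zero>\<^bsub>?R\<^esub> \<in> carrier ?R" by (simp add: C)
  show "\<exists>y\<in>carrier ?R. y \<oplus>\<^bsub>?R\<^esub> x = \<zero>\<^bsub>?R\<^esub>" if "x \<in> carrier ?R" for x
    by (rule bexI[of _ "- x"]) (use that in \<open>simp_all add: C\<close>)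
  show "\<one>\<^bsub>?R\<^esub> \<in> carrier ?R" by (auto simp: C generated_semigroup_0)
  show "x \<otimes>\<^bsub>?R\<^esub> y \<in> carrier ?R" if "x \<in> carrier ?R" "y \<in> carrier ?R" for x y
    unfolding C semigroup_ring_simps
  proof safe
    fix n assume "fps_nth (x * y) n \<noteq> 0"
    then obtain i where i: "i \<le> n" "fps_nth x i \<noteq> 0" "fps_nth y (n - i) \<noteq> 0"
      unfolding fps_mult_nth
      by (metis (no_types, lifting) atLeastAtMost_iff mult_eq_0_iff sum.neutral)
    then have "i + (n - i) \<in> generated_semigroup S"
      using that unfolding C by (intro generated_semigroup_add) blast+
    then show "n \<in> generated_semigroup S" using i by simp
  qed
qed (simp_all add: algebra_simps)

lemma max_ideal_eq:
  assumes "finite S" "0 \<notin> S"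
  shows "(max_ideal S :: 'k::field fps set) =
    {f \<in> carrier (semigroup_ring S). fps_nth f 0 = 0}"
proof
  note C = carrier_semigroup_ring[OF assms]
  let ?R = "semigroup_ring S :: 'k fps ring"
  interpret R: cring ?R by (rule cring_semigroup_ring[OF assms])
  have gens: "(\<lambda>s. fps_X ^ s) ` S \<subseteq> carrier ?R"
    using generator_in_generated_semigroup[OF assms(1)]
    by (auto simp: C split: if_splits)
  have inv: "\<ominus>\<^bsub>?R\<^esub> x = - x" if "x \<in> carrier ?R" for x
    by (rule R.minus_equality) (use that in \<open>auto simp: C\<close>)
  let ?I = "{f \<in> carrier ?R. fps_nth f 0 = 0}"
  have "ideal ?I ?R"
  proof (rule idealI)
    show "ring ?R" by (rule R.ring_axioms)
    show "subgroup ?I (add_monoid ?R)"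
    proof (rule R.add.subgroupI)
      show "?I \<noteq> {}" using R.zero_closed by force
      show "\<ominus>\<^bsub>?R\<^esub> x \<in> ?I" if "x \<in> ?I" for x
        using that R.a_inv_closed[of x] inv[of x] by simp
      show "x \<oplus>\<^bsub>?R\<^esub> y \<in> ?I" if "x \<in> ?I" "y \<in> ?I" for x y
        using that R.a_closed[of x y] by simp
    qed blast
    show "x \<otimes>\<^bsub>?R\<^esub> a \<in> ?I" if "a \<in> ?I" "x \<in> carrier ?R" for a x
      using that R.m_closed[of x a] by simp
    show "a \<otimes>\<^bsub>?R\<^esub> x \<in> ?I" if "a \<in> ?I" "x \<in> carrier ?R" for a x
      using that R.m_closed[of a x] by simp
  qed
  then show "max_ideal S \<subseteq> ?I"
    unfolding max_ideal_def
    by (rule R.genideal_minimal) (use gens assms in \<open>auto intro!: gr0I\<close>)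
  show "?I \<subseteq> max_ideal S"
  proof
    fix f assume f: "f \<in> ?I"
    interpret I: ideal "max_ideal S" ?R
      unfolding max_ideal_def by (rule R.genideal_ideal[OF gens])
    define p where "p n s \<longleftrightarrow> s \<in> S \<and> s \<le> n \<and> n - s \<in> generated_semigroup S" for n s
    define r where "r n = (SOME s. p n s)" for n
    have r: "p n (r n)" if "fps_nth f n \<noteq> 0" for n
    proof -
      have "n \<in> generated_semigroup S"
        using f that unfolding C by blast
      moreover have "n \<noteq> 0"
        using f that by (metis (mono_tags, lifting) mem_Collect_eq)
      ultimately have "\<exists>s. p n s"
        unfolding p_def using generated_semigroup_peel[OF assms(1)] by metis
      then show ?thesis unfolding r_def by (rule someI_ex)
    qed
    define g where
      "g s = Abs_fps (\<lambda>j. if r (j + s) = s then fps_nth f (j + s) else 0)" for s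
    have g: "g s \<in> carrier ?R" for s
      unfolding C g_def using r by (fastforce simp: p_def split: if_splits)
    have "f = (\<Sum>s\<in>S. g s * fps_X ^ s)"
    proof (rule fps_ext)
      fix n
      have "fps_nth (\<Sum>s\<in>S. g s * fps_X ^ s) n =
          (\<Sum>s\<in>S. if s = r n then fps_nth f n else 0)"
        unfolding fps_sum_nth fps_X_power_mult_right_nth
      proof (rule sum.cong)
        fix s assume "s \<in> S"
        show "(if n < s then 0 else fps_nth (g s) (n - s)) = (if s = r n then fps_nth f n else 0)"
          using r[of n] by (cases "fps_nth f n = 0") (auto simp: g_def p_def)
      qed simp
      also have "\<dots> = fps_nth f n"
        using r[of n] assms(1) by (cases "fps_nth f n = 0") (auto simp: p_def)
      finally show "fps_nth f n = fps_nth (\<Sum>s\<in>S. g s * fps_X ^ s) n" by simp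
    qed
    moreover have "(\<Sum>s\<in>T. g s * fps_X ^ s) \<in> max_ideal S" if "T \<subseteq> S" for T
      using finite_subset[OF that assms(1)] that
    proof (induction T rule: finite_induct)
      case empty
      then show ?case using I.zero_closed by simp
    next
      case (insert s T)
      have "(fps_X ^ s :: 'k fps) \<in> max_ideal S"
        unfolding max_ideal_def
        by (rule subsetD[OF R.genideal_self[OF gens]]) (use insert.prems in simp)
      then have "g s * fps_X ^ s \<in> max_ideal S"
        using I.I_l_closed[of "fps_X ^ s" "g s"] g[of s] by simp
      moreover have "(\<Sum>s\<in>T. g s * fps_X ^ s) \<in> max_ideal S"
        using insert.IH insert.prems by simp
      ultimately show ?case
        using I.a_closed[of "g s * fps_X ^ s" "\<Sum>s\<in>T. g s * fps_X ^ s"] insert.hyps by simp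
    qed
    from this[OF order_refl] have "(\<Sum>s\<in>S. g s * fps_X ^ s) \<in> max_ideal S" .
    ultimately show "f \<in> max_ideal S" by simp
  qed
qed

lemma hilbert_function_cong:
  assumes "finite S" "0 \<notin> S" "finite S'" "0 \<notin> S'"
    and "generated_semigroup S = generated_semigroup S'"
  shows "hilbert_function TYPE('k::field) S = hilbert_function TYPE('k) S'"
proof -
  have "(semigroup_ring S :: 'k fps ring) = semigroup_ring S'"
    using assms carrier_semigroup_ring[of S] carrier_semigroup_ring[of S']
    by (intro partial_object.equality monoid.equality ring.equality) auto
  moreover from this have "(max_ideal S :: 'k fps set) = max_ideal S'"
    using assms by (simp add: max_ideal_eq)
  ultimately show ?thesis
    by (simp add: hilbert_function_def max_ideal_power_def fun_eq_iff)
qed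

end

theory Submission
  imports Defs
begin

text \<open>Write \<open>\<Gamma>\<close> for the semigroup, \<open>M = \<Gamma> - {0}\<close>, and \<open>nM\<close> for the set of sums of \<open>n\<close> elements
  of \<open>M\<close>, with \<open>0M\<close> read as \<open>\<Gamma>\<close>.

  The ring, its maximal ideal and the powers of that ideal consist of all power series supported on
  \<open>\<Gamma>\<close>, \<open>M\<close> and \<open>nM\<close>. So the classes of the monomials \<open>t\<^sup>x\<close> with \<open>x \<in> nM - (n+1)M\<close> form a basis of
  \<open>\<mm>\<^sup>n / \<mm>\<^sup>n\<^sup>+\<^sup>1\<close>, and the Hilbert function counts the elements of \<open>\<Gamma>\<close> whose longest factorization
  into generators has length exactly \<open>n\<close>: this is \<open>hilbert_function_eq_card\<close>.

  For the semigroup at hand, coprimality of \<open>m\<close> and \<open>d\<close> lets one write each element uniquely as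
  \<open>a m + b d\<close> with \<open>b < m\<close>. The generators have coordinates \<open>(1, 0)\<close>, \<open>(1, 1)\<close> and
  \<open>(q + 1, q + i)\<close>; call those of the last kind long. If \<open>b \<le> a\<close>, the first two
  suffice, and the longest factorization has length \<open>a\<close>. If \<open>b > a\<close>, one long generator is needed; it costs \<open>q + 1\<close> units of \<open>a\<close>, and the longest
  factorization has length \<open>a - q\<close>. Nothing longer arises from sums of generators whose second
  coordinate reaches \<open>m\<close>: replacing \<open>(a, b)\<close> by \<open>(a + d, b - m)\<close> only relaxes these bounds. This
  description is \<open>long_sums_iff\<close>.

  Adding \<open>m\<close> maps \<open>(a, b)\<close> to \<open>(a + 1, b)\<close> and thereby raises the maximal length by exactly one,
  unless this step makes the long generator superfluous. For maximal length \<open>n\<close> that happens only at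
  \<open>(n + q, n + q + 1)\<close>, and sending this one pair to \<open>(n + 1, n + 1)\<close> instead keeps the map
  injective (\<open>card_len_set_mono\<close>).\<close>


section \<open>Powers of the maximal ideal as monomial ideals\<close>

text \<open>The elements of \<open>\<Gamma>\<close> that are a sum of at least \<open>n\<close> generators. This agrees with \<open>nM\<close> for
  \<open>n > 0\<close>; the value \<open>\<Gamma>\<close> at \<open>n = 0\<close> fits \<open>\<mm>\<^sup>0\<close> being the whole ring.\<close>

fun long_sums :: "nat set \<Rightarrow> nat \<Rightarrow> nat set" where
  "long_sums S 0 = generated_semigroup S"
| "long_sums S (Suc n) = {s + y | s y. s \<in> S \<and> y \<in> long_sums S n}"

lemma long_sums_SucI: "s \<in> S \<Longrightarrow> y \<in> long_sums S n \<Longrightarrow> s + y \<in> long_sums S (Suc n)"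
  by auto

lemma long_sums_add_semigroup:
  "x \<in> long_sums S n \<Longrightarrow> g \<in> generated_semigroup S \<Longrightarrow> x + g \<in> long_sums S n"
proof (induction n arbitrary: x)
  case 0
  then show ?case by (simp add: generated_semigroup_add)
next
  case (Suc n)
  then obtain s y where "s \<in> S" "y \<in> long_sums S n" "x = s + y" by auto
  with Suc.IH[of y] Suc.prems show ?case by (auto simp: add.assoc)
qed

lemma long_sums_Suc_subset:
  assumes "finite S"
  shows "long_sums S (Suc n) \<subseteq> long_sums S n"
proof
  fix x assume "x \<in> long_sums S (Suc n)"
  then obtain s y where "s \<in> S" "y \<in> long_sums S n" "x = s + y" by auto
  then show "x \<in> long_sums S n"
    using long_sums_add_semigroup[of y S n s] generator_in_generated_semigroup[OF assms, of s]
    by (simp add: add.commute)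
qed

lemma long_sums_subset_semigroup:
  assumes "finite S"
  shows "long_sums S n \<subseteq> generated_semigroup S"
proof (induction n)
  case (Suc n)
  then show ?case using long_sums_Suc_subset[OF assms] by blast
qed simp

lemma long_sums_add_nonzero:
  assumes "finite S" "x \<in> long_sums S n" "g \<in> generated_semigroup S" "g \<noteq> 0"
  shows "x + g \<in> long_sums S (Suc n)"
proof -
  obtain s where s: "s \<in> S" "s \<le> g" "g - s \<in> generated_semigroup S"
    using generated_semigroup_peel[OF assms(1,3,4)] by metis
  have "x + (g - s) \<in> long_sums S n"
    using long_sums_add_semigroup[OF assms(2) s(3)] .
  moreover have "x + g = s + (x + (g - s))" using s(2) by simp
  ultimately show ?thesis using s(1) unfolding long_sums.simps by blast
qed

lemma finite_long_sums_diff: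
  assumes "finite S"
  shows "finite (long_sums S n - long_sums S (Suc n))"
proof (induction n)
  case 0
  have "long_sums S 0 - long_sums S (Suc 0) \<subseteq> {0}"
    using long_sums_add_nonzero[OF assms, of 0 0] by (auto simp: generated_semigroup_0)
  then show ?case by (rule finite_subset) simp
next
  case (Suc n)
  have "long_sums S (Suc n) - long_sums S (Suc (Suc n))
      \<subseteq> (\<Union>s\<in>S. (+) s ` (long_sums S n - long_sums S (Suc n)))" by auto
  then show ?case
    by (rule finite_subset) (use Suc assms in simp)
qed

definition supported_on :: "nat set \<Rightarrow> 'k::field fps set" where
  "supported_on A = {f. \<forall>n. fps_nth f n \<noteq> 0 \<longrightarrow> n \<in> A}"

lemma supported_onD: "f \<in> supported_on A \<Longrightarrow> fps_nth f n \<noteq> 0 \<Longrightarrow> n \<in> A"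
  by (simp add: supported_on_def)

lemma supported_on_add:
  assumes "f \<in> supported_on A" "g \<in> supported_on A"
  shows "f + g \<in> supported_on A"
  unfolding supported_on_def
proof safe
  fix n assume "fps_nth (f + g) n \<noteq> 0"
  then have "fps_nth f n \<noteq> 0 \<or> fps_nth g n \<noteq> 0" by auto
  then show "n \<in> A" using assms supported_onD by metis
qed

lemma carrier_eq_supported_on:
  assumes "finite S" "0 \<notin> S"
  shows "carrier (semigroup_ring S) = supported_on (generated_semigroup S)"
  by (simp add: carrier_semigroup_ring[OF assms] supported_on_def)

lemma sum_in_ideal_prod:
  assumes "finite T" "(0 :: 'k::field fps) \<in> I" "0 \<in> J"
    and "\<And>s. s \<in> T \<Longrightarrow> g s \<in> I" "\<And>s. s \<in> T \<Longrightarrow> h s \<in> J"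
  shows "(\<Sum>s\<in>T. g s * h s) \<in> ideal_prod (semigroup_ring S) I J"
  using assms(1,4,5)
proof (induction T rule: finite_induct)
  case empty
  then show ?case
    using ideal_prod.prod[OF assms(2,3), of "semigroup_ring S"] by simp
next
  case (insert s T)
  then have "g s * h s \<in> ideal_prod (semigroup_ring S) I J"
    using ideal_prod.prod[of "g s" I "h s" J "semigroup_ring S"] by simp
  then show ?case
    using insert ideal_prod.sum[of "g s * h s" "semigroup_ring S" I J "\<Sum>s\<in>T. g s * h s"] by simp
qed

text \<open>One step of the description of \<open>\<mm>\<^sup>n\<close>. For the inclusion from right to left, a series need not be
  a finite sum of monomials, but it splits into finitely many pieces, according to a generator \<open>s\<close>
  that can be removed from each exponent; the piece of \<open>s\<close> is \<open>t\<^sup>s\<close> times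
  an element of \<open>\<mm>\<^sup>n\<close>.\<close>

lemma ideal_prod_supported_on:
  assumes "finite S" "0 \<notin> S"
  shows "ideal_prod (semigroup_ring S) (supported_on (long_sums S n)) (max_ideal S) =
    (supported_on (long_sums S (Suc n)) :: 'k::field fps set)" (is "?L = ?Rhs")
proof
  note mi = max_ideal_eq[OF assms] and C = carrier_eq_supported_on[OF assms]
  show "?L \<subseteq> ?Rhs"
  proof
    fix f :: "'k fps" assume "f \<in> ?L"
    then show "f \<in> ?Rhs"
    proof (induction rule: ideal_prod.induct)
      case (prod i j)
      show ?case
        unfolding supported_on_def semigroup_ring_simps
      proof safe
        fix k assume "fps_nth (i * j) k \<noteq> 0"
        then obtain l where l: "l \<le> k" "fps_nth i l \<noteq> 0" "fps_nth j (k - l) \<noteq> 0"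
          unfolding fps_mult_nth
          by (metis (no_types, lifting) atLeastAtMost_iff mult_eq_0_iff sum.neutral)
        have "l \<in> long_sums S n" using supported_onD[OF prod(1) l(2)] .
        moreover have "k - l \<in> generated_semigroup S" "k - l \<noteq> 0"
          using prod(2) l(3) supported_onD[of j] by (auto simp: mi C intro!: gr0I)
        ultimately have "l + (k - l) \<in> long_sums S (Suc n)"
          by (rule long_sums_add_nonzero[OF assms(1)])
        then show "k \<in> long_sums S (Suc n)" using l(1) by simp
      qed
    next
      case (sum f g)
      then show ?case using supported_on_add by simp
    qed
  qed
  show "?Rhs \<subseteq> ?L"
  proof
    fix f :: "'k fps" assume f: "f \<in> ?Rhs"
    define p where "p k s \<longleftrightarrow> s \<in> S \<and> s \<le> k \<and> k - s \<in> long_sums S n" for k s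
    define r where "r k = (SOME s. p k s)" for k
    have r: "p k (r k)" if "fps_nth f k \<noteq> 0" for k
    proof -
      have "k \<in> long_sums S (Suc n)" using supported_onD[OF f that] .
      then have "\<exists>s. p k s" unfolding p_def by auto
      then show ?thesis unfolding r_def by (rule someI_ex)
    qed
    define g where
      "g s = Abs_fps (\<lambda>j. if r (j + s) = s then fps_nth f (j + s) else 0)" for s
    have g: "g s \<in> supported_on (long_sums S n)" for s
      unfolding supported_on_def g_def using r by (fastforce simp: p_def split: if_splits)
    have "f = (\<Sum>s\<in>S. g s * fps_X ^ s)"
    proof (rule fps_ext)
      fix k
      have "fps_nth (\<Sum>s\<in>S. g s * fps_X ^ s) k =
          (\<Sum>s\<in>S. if s = r k then fps_nth f k else 0)"
        unfolding fps_sum_nth fps_X_power_mult_right_nth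
      proof (rule sum.cong)
        fix s assume "s \<in> S"
        show "(if k < s then 0 else fps_nth (g s) (k - s)) = (if s = r k then fps_nth f k else 0)"
          using r[of k] by (cases "fps_nth f k = 0") (auto simp: g_def p_def)
      qed simp
      also have "\<dots> = fps_nth f k"
        using r[of k] assms(1) by (cases "fps_nth f k = 0") (auto simp: p_def)
      finally show "fps_nth f k = fps_nth (\<Sum>s\<in>S. g s * fps_X ^ s) k" by simp
    qed
    moreover have "fps_X ^ s \<in> (max_ideal S :: 'k fps set)" if "s \<in> S" for s
      using that assms generator_in_generated_semigroup[OF assms(1) that]
      by (auto simp: mi C supported_on_def intro!: gr0I)
    moreover have "(0 :: 'k fps) \<in> supported_on (long_sums S n)" "(0 :: 'k fps) \<in> max_ideal S"
      by (auto simp: mi C supported_on_def)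
    ultimately show "f \<in> ?L"
      using sum_in_ideal_prod[OF assms(1), of "supported_on (long_sums S n)" "max_ideal S"
          g "\<lambda>s. fps_X ^ s" S] g by simp
  qed
qed

lemma max_ideal_power_eq:
  assumes "finite S" "0 \<notin> S"
  shows "max_ideal_power S n = (supported_on (long_sums S n) :: 'k::field fps set)"
proof (induction n)
  case 0
  then show ?case
    by (simp add: max_ideal_power_def ideals_set_def carrier_eq_supported_on[OF assms])
next
  case (Suc n)
  have "max_ideal_power S (Suc n) = ideal_prod (semigroup_ring S)
      (max_ideal_power S n) (max_ideal S :: 'k fps set)"
    by (simp add: max_ideal_power_def ideals_set_def)
  then show ?case
    using Suc ideal_prod_supported_on[OF assms] by simp
qed

lemma ideal_max_ideal_power:
  assumes "finite S" "0 \<notin> S"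
  shows "ideal (max_ideal_power S n :: 'k::field fps set) (semigroup_ring S)"
proof -
  let ?R = "semigroup_ring S :: 'k fps ring"
  interpret R: cring ?R by (rule cring_semigroup_ring[OF assms])
  interpret I: comm_monoid "ideals_set ?R" by (rule R.ideals_set_is_comm_monoid)
  have "(\<lambda>s. fps_X ^ s) ` S \<subseteq> carrier ?R"
    using generator_in_generated_semigroup[OF assms(1)]
    by (auto simp: carrier_semigroup_ring[OF assms] split: if_splits)
  then have "ideal (max_ideal S) ?R"
    unfolding max_ideal_def by (rule R.genideal_ideal)
  then show ?thesis
    using I.nat_pow_closed[of "max_ideal S" n] by (simp add: max_ideal_power_def ideals_set_def)
qed


section \<open>The Hilbert function as a count\<close>

lemma subfield_constants:
  assumes "finite S" "0 \<notin> S"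
  shows "subfield (range fps_const) (semigroup_ring S :: 'k::field fps ring)"
proof -
  let ?R = "semigroup_ring S :: 'k fps ring"
  interpret R: cring ?R by (rule cring_semigroup_ring[OF assms])
  have sub: "range fps_const \<subseteq> carrier ?R"
    by (auto simp: carrier_semigroup_ring[OF assms] generated_semigroup_0 split: if_splits)
  have inv: "\<ominus>\<^bsub>?R\<^esub> fps_const c = fps_const (- c)" for c :: 'k
    by (rule R.minus_equality) (use sub in auto)
  have "subring (range fps_const) ?R"
    by (rule R.subringI) (use sub inv in auto)
  then have "subcring (range fps_const) ?R"
    by (rule R.subcringI')
  then show ?thesis
  proof (rule R.subfieldI)
    show "Units (?R\<lparr>carrier := range fps_const\<rparr>) = range fps_const - {\<zero>\<^bsub>?R\<^esub>}"
    proof (intro equalityI subsetI)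
      fix u assume "u \<in> range fps_const - {\<zero>\<^bsub>?R\<^esub>}"
      then obtain c :: 'k where "u = fps_const c" "c \<noteq> 0" by auto
      then have "fps_const (inverse c) * u = 1" "u * fps_const (inverse c) = 1" "u \<in> range fps_const"
        by simp_all
      then show "u \<in> Units (?R\<lparr>carrier := range fps_const\<rparr>)"
        unfolding Units_def by fastforce
    qed (auto simp: Units_def)
  qed
qed

text \<open>The classes of the monomials \<open>t\<^sup>x\<close>, \<open>x \<in> nM - (n+1)M\<close>, are a basis of \<open>\<mm>\<^sup>n / \<mm>\<^sup>n\<^sup>+\<^sup>1\<close>: adjoining
  the exponents to \<open>(n+1)M\<close> one at a time, each raises the dimension by one, since no series without
  a term of degree \<open>x\<close> is congruent to \<open>t\<^sup>x\<close>.\<close>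

lemma hilbert_function_eq_card:
  assumes "finite S" "0 \<notin> S"
  shows "hilbert_function TYPE('k::field) S n = card (long_sums S n - long_sums S (Suc n))"
proof -
  let ?R = "semigroup_ring S :: 'k fps ring"
  define P where "P = long_sums S (Suc n)"
  define I where "I = (supported_on P :: 'k fps set)"
  define h where "h = (\<lambda>f. I +>\<^bsub>?R\<^esub> f)"
  define \<kappa> where "\<kappa> = h ` range fps_const"
  note C = carrier_eq_supported_on[OF assms, where 'a = 'k]
  interpret R: cring ?R by (rule cring_semigroup_ring[OF assms])
  interpret I: ideal I ?R
    using ideal_max_ideal_power[OF assms, of "Suc n"]
    unfolding max_ideal_power_eq[OF assms] I_def P_def .
  interpret H: ring_hom_ring ?R "?R Quot I" h
    unfolding h_def by (rule I.rcos_ring_hom_ring)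
  have minus: "f \<ominus>\<^bsub>?R\<^esub> g = f - g" if "f \<in> carrier ?R" "g \<in> carrier ?R" for f g
  proof -
    have "- g \<in> carrier ?R" using that by (simp add: C supported_on_def)
    then have "\<ominus>\<^bsub>?R\<^esub> g = - g" by (intro R.minus_equality) (use that in auto)
    then show ?thesis by (simp add: a_minus_def)
  qed
  have h_eq_iff: "h f = h g \<longleftrightarrow> f - g \<in> I" if "f \<in> carrier ?R" "g \<in> carrier ?R" for f g
    using R.quotient_eq_iff_same_a_r_cos[OF I.ideal_axioms that] minus[OF that]
    by (simp add: h_def)
  have const: "fps_const c \<in> carrier ?R" for c
    by (simp add: C supported_on_def generated_semigroup_0)
  have P_sub: "P \<subseteq> long_sums S n" "long_sums S n \<subseteq> generated_semigroup S"
    unfolding P_def using long_sums_Suc_subset long_sums_subset_semigroup assms(1) by auto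
  have "0 \<notin> P"
    unfolding P_def using assms(2) by auto
  have h_0: "h 0 = \<zero>\<^bsub>?R Quot I\<^esub>"
    using H.hom_zero by simp
  have "subfield \<kappa> (?R Quot I)"
    unfolding \<kappa>_def
  proof (rule H.img_is_subfield(2)[OF subfield_constants[OF assms]])
    have "(1 :: 'k fps) \<notin> I"
      using \<open>0 \<notin> P\<close> by (auto simp: I_def supported_on_def)
    then have "h 1 \<noteq> h 0"
      using h_eq_iff[of 1 0] R.one_closed R.zero_closed by simp
    then show "\<one>\<^bsub>?R Quot I\<^esub> \<noteq> \<zero>\<^bsub>?R Quot I\<^esub>"
      using h_0 H.hom_one by simp
  qed
  moreover have "ring.dimension (?R Quot I) (card A) \<kappa> (h ` supported_on (A \<union> P))"
    if "finite A" "A \<subseteq> long_sums S n - P" for A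
    using that
  proof (induction A rule: finite_induct)
    case empty
    have "h f = h 0" if "f \<in> I" for f
      using that h_eq_iff[of f 0] I.Icarr R.zero_closed by simp
    moreover have "0 \<in> I" by (simp add: I_def supported_on_def)
    ultimately have "h ` I = {\<zero>\<^bsub>?R Quot I\<^esub>}" using h_0 by force
    then show ?case using H.S.dimension.zero_dim[of \<kappa>] by (simp add: I_def)
  next
    case (insert a A)
    let ?E = "h ` supported_on (A \<union> P)"
    have a: "a \<notin> A" "a \<notin> P" "a \<in> generated_semigroup S"
      using insert P_sub by auto
    have X: "fps_X ^ a \<in> carrier ?R"
      using a(3) by (auto simp: C supported_on_def)
    have sup: "supported_on (insert a A \<union> P) \<subseteq> carrier ?R"
      using insert.prems P_sub unfolding C supported_on_def by blast
    then have supA: "supported_on (A \<union> P) \<subseteq> carrier ?R"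
      unfolding supported_on_def by blast
    have "h (fps_X ^ a) \<notin> ?E"
    proof
      assume "h (fps_X ^ a) \<in> ?E"
      then obtain g where g: "g \<in> supported_on (A \<union> P)" "h (fps_X ^ a) = h g" by blast
      then have "fps_X ^ a - g \<in> I"
        using h_eq_iff X supA by blast
      moreover have "fps_nth g a = 0"
        using g(1) a by (auto simp: supported_on_def)
      ultimately show False
        using a(2) supported_onD[of "fps_X ^ a - g" P a] by (simp add: I_def)
    qed
    moreover have "ring.line_extension (?R Quot I) \<kappa> (h (fps_X ^ a)) ?E =
        h ` supported_on (insert a A \<union> P)"
    proof (intro equalityI subsetI)
      fix u assume "u \<in> ring.line_extension (?R Quot I) \<kappa> (h (fps_X ^ a)) ?E"
      then obtain c g where cg: "g \<in> supported_on (A \<union> P)"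
          "u = h (fps_const c) \<otimes>\<^bsub>?R Quot I\<^esub> h (fps_X ^ a) \<oplus>\<^bsub>?R Quot I\<^esub> h g"
        unfolding H.S.line_extension_mem_iff \<kappa>_def by auto
      then have "u = h (fps_const c * fps_X ^ a + g)"
        using H.hom_mult[OF const X, of c] H.hom_add[of "fps_const c * fps_X ^ a" g]
          R.m_closed[OF const X, of c] supA by auto
      moreover have "fps_const c * fps_X ^ a + g \<in> supported_on (insert a A \<union> P)"
        using cg(1) by (auto simp: supported_on_def split: if_splits)
      ultimately show "u \<in> h ` supported_on (insert a A \<union> P)" by blast
    next
      fix u assume "u \<in> h ` supported_on (insert a A \<union> P)"
      then obtain f where f: "f \<in> supported_on (insert a A \<union> P)" "u = h f" by blast
      let ?c = "fps_nth f a"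
      let ?g = "f - fps_const ?c * fps_X ^ a"
      have g: "?g \<in> supported_on (A \<union> P)"
        using f(1) by (auto simp: supported_on_def split: if_splits)
      have "u = h (fps_const ?c * fps_X ^ a + ?g)" using f(2) by simp
      also have "\<dots> = h (fps_const ?c) \<otimes>\<^bsub>?R Quot I\<^esub> h (fps_X ^ a) \<oplus>\<^bsub>?R Quot I\<^esub> h ?g"
        using H.hom_mult[OF const X, of ?c] H.hom_add[of "fps_const ?c * fps_X ^ a" ?g]
          R.m_closed[OF const X, of ?c] supA g by auto
      finally show "u \<in> ring.line_extension (?R Quot I) \<kappa> (h (fps_X ^ a)) ?E"
        unfolding H.S.line_extension_mem_iff \<kappa>_def using g by blast
    qed
    ultimately show ?case
      using H.S.dimension.Suc_dim[of "h (fps_X ^ a)" ?E "card A" \<kappa>] H.hom_closed[OF X] insert by simp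
  qed
  from this[OF _ order_refl]
  have "ring.dimension (?R Quot I) (card (long_sums S n - P)) \<kappa> (h ` supported_on (long_sums S n))"
    using finite_long_sums_diff[OF assms(1), of n] P_sub(1) by (simp add: P_def Un_absorb2)
  ultimately have "ring.dim (?R Quot I) \<kappa> (h ` supported_on (long_sums S n)) =
      card (long_sums S n - P)"
    using H.S.dimI unfolding over_def by blast
  then show ?thesis
    by (simp add: hilbert_function_def Let_def max_ideal_power_eq[OF assms] \<kappa>_def h_def I_def P_def)
qed


section \<open>Maximal factorization lengths in coordinates\<close>

text \<open>The element \<open>a m + b d\<close>, \<open>b < m\<close>, is a sum of at least \<open>n\<close> generators. The first alternative
  is a factorization into \<open>a - b\<close> copies of \<open>m\<close> and \<open>b\<close> copies of \<open>m + d\<close>; the second one is for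
  \<open>b > a\<close>, where exactly one of the long generators is used.\<close>

definition len_ge :: "nat \<Rightarrow> nat \<Rightarrow> nat \<Rightarrow> nat \<Rightarrow> nat \<Rightarrow> bool" where
  "len_ge e q n a b \<longleftrightarrow>
    b \<le> a \<and> n \<le> a \<or> q + 1 \<le> a \<and> b + 2 \<le> a + e \<and> n + q \<le> a"

definition len_set :: "nat \<Rightarrow> nat \<Rightarrow> nat \<Rightarrow> (nat \<times> nat) set" where
  "len_set e q n =
    {(a, b). b < e + 2 * q + 1 \<and> len_ge e q n a b \<and> \<not> len_ge e q (Suc n) a b}"

text \<open>The map \<open>(a, b) \<mapsto> (a + 1, b)\<close> raises the maximal length by one except at
  \<open>(n + q, n + q + 1)\<close>. The replacement value \<open>(n + 1, n + 1)\<close> is not attained otherwise: its only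
  candidate preimage \<open>(n, n + 1)\<close> needs a long generator and so has maximal length at most
  \<open>n - q < n\<close>.\<close>

lemma card_len_set_mono:
  assumes "q \<ge> 1"
  shows "card (len_set e q n) \<le> card (len_set e q (Suc n))"
proof (rule card_inj_on_le)
  let ?f = "\<lambda>(a, b). if b = a + 1 then (n + 1, n + 1) else (a + 1, b :: nat)"
  have len_set: "(a, b) \<in> len_set e q k \<longleftrightarrow> b < e + 2 * q + 1 \<and>
      (b \<le> a \<and> a = k \<or> a < b \<and> q + 1 \<le> a \<and> b + 2 \<le> a + e \<and> a = k + q)" for a b k
    using assms unfolding len_set_def len_ge_def mem_Collect_eq prod.case by linarith
  show "inj_on ?f (len_set e q n)"
  proof (rule inj_onI, clarify)
    fix a b a' b'
    assume "(a, b) \<in> len_set e q n" "(a', b') \<in> len_set e q n"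
      and "(if b = a + 1 then (n + 1, n + 1) else (a + 1, b)) =
           (if b' = a' + 1 then (n + 1, n + 1) else (a' + 1, b'))"
    then show "a = a' \<and> b = b'"
      using assms unfolding len_set by (auto split: if_splits)
  qed
  show "?f ` len_set e q n \<subseteq> len_set e q (Suc n)"
  proof (rule image_subsetI)
    fix x assume "x \<in> len_set e q n"
    then show "?f x \<in> len_set e q (Suc n)"
      using assms by (cases x; cases "snd x = fst x + 1") (auto simp: len_set)
  qed
  show "finite (len_set e q (Suc n))"
    by (rule finite_subset[of _ "{..<n + q + 2} \<times> {..<e + 2 * q + 1}"])
       (auto simp: len_set_def len_ge_def)
qed

lemma coordinates_unique:
  fixes m d :: nat
  assumes "coprime m d" "b < m" "b' < m" "a * m + b * d = a' * m + b' * d"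
  shows "a = a' \<and> b = b'"
proof -
  have "b = b'" if "b \<le> b'" "b' < m" "a * m + b * d = a' * m + b' * d" for a b a' b'
  proof -
    have "a * m = a' * m + (b' - b) * d"
      using that by (simp add: diff_mult_distrib)
    then have "m dvd (b' - b) * d"
      by (metis dvd_add_right_iff dvd_triv_right)
    then have "m dvd b' - b"
      using assms(1) by (simp add: coprime_dvd_mult_left_iff)
    then show ?thesis using that nat_dvd_not_less[of "b' - b" m] by fastforce
  qed
  from this[of b b' a a'] this[of b' b a' a] have "b = b'"
    using assms by (metis nat_le_linear)
  then show ?thesis using assms by auto
qed

locale long_generator_semigroup =
  fixes e q d m :: nat and S :: "nat set"
  assumes e: "e \<ge> 4" and m: "m = e + 2 * q + 1" and coprime: "coprime m d"
    and S: "S = {m, m + d} \<union> {(q + 1) * m + (q + i) * d | i. 2 \<le> i \<and> i \<le> e - 1}"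
begin

lemma finite_S: "finite S"
proof -
  have "{(q + 1) * m + (q + i) * d | i. 2 \<le> i \<and> i \<le> e - 1}
      = (\<lambda>i. (q + 1) * m + (q + i) * d) ` {2..e - 1}" by auto
  then show ?thesis by (simp add: S)
qed

lemma zero_notin_S: "0 \<notin> S"
  by (auto simp: S m)

abbreviation lin :: "nat \<Rightarrow> nat \<Rightarrow> nat" where
  "lin a b \<equiv> a * m + b * d"

lemma lin_wrap: "b \<ge> m \<Longrightarrow> lin a b = lin (a + d) (b - m)"
  by (simp add: algebra_simps diff_mult_distrib2)

text \<open>Adding a generator adds coordinates, followed by \<open>(a, b) \<mapsto> (a + d, b - m)\<close> if the second one
  reaches \<open>m\<close>. Two long generators together never need more than one: their combined first
  coordinate is large enough to satisfy the bound \<open>b + 2 \<le> a + e\<close> for every \<open>b < m\<close>, and after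
  wrapping, the second coordinate is small.\<close>

lemma len_ge_add_generator:
  assumes "s \<in> S" "b < m" "len_ge e q n a b"
  shows "\<exists>a' b'. s + lin a b = lin a' b' \<and> b' < m \<and> len_ge e q (Suc n) a' b'"
proof -
  have reduce: ?thesis
    if "s = lin u v" "v < m" "b + v < m \<Longrightarrow> len_ge e q (Suc n) (a + u) (b + v)"
       "b + v \<ge> m \<Longrightarrow> len_ge e q (Suc n) (a + u + d) (b + v - m)" for u v
  proof (cases "b + v < m")
    case True
    then show ?thesis
      using that by (intro exI[of _ "a + u"] exI[of _ "b + v"]) (simp add: algebra_simps)
  next
    case False
    then show ?thesis
      using that assms(2) lin_wrap[of "b + v" "a + u"]
      by (intro exI[of _ "a + u + d"] exI[of _ "b + v - m"]) (simp add: algebra_simps)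
  qed
  consider "s = lin 1 0" | "s = lin 1 1"
    | i where "s = lin (q + 1) (q + i)" "2 \<le> i" "i \<le> e - 1"
    using assms(1) by (auto simp: S)
  then show ?thesis
  proof cases
    case 1
    then show ?thesis
      by (rule reduce) (use assms m in \<open>auto simp: len_ge_def\<close>)
  next
    case 2
    then show ?thesis
      by (rule reduce) (use assms m e in \<open>auto simp: len_ge_def\<close>)
  next
    case (3 i)
    from 3(1) show ?thesis
    proof (rule reduce)
      show "q + i < m" using 3 m e by linarith
      show "len_ge e q (Suc n) (a + (q + 1)) (b + (q + i))"
        if "b + (q + i) < m"
        using that assms(3) 3 m e unfolding len_ge_def by linarith
      show "len_ge e q (Suc n) (a + (q + 1) + d) (b + (q + i) - m)"
        if "m \<le> b + (q + i)"
        using that assms(2,3) 3 m e unfolding len_ge_def by linarith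
    qed
  qed
qed

lemma long_sums_imp_len_ge:
  "x \<in> long_sums S n \<Longrightarrow> \<exists>a b. x = lin a b \<and> b < m \<and> len_ge e q n a b"
proof (induction n arbitrary: x)
  case 0
  then have "x \<in> generated_semigroup S" by simp
  then show ?case
  proof (induction x rule: less_induct)
    case (less x)
    show ?case
    proof (cases "x = 0")
      case True
      then show ?thesis by (intro exI[of _ 0]) (simp add: m len_ge_def)
    next
      case False
      then obtain s where s: "s \<in> S" "s \<le> x" "x - s \<in> generated_semigroup S"
        using generated_semigroup_peel[OF finite_S less.prems] by metis
      moreover have "s \<noteq> 0" using s(1) zero_notin_S by metis
      ultimately obtain a b where ab: "x - s = lin a b" "b < m" "len_ge e q 0 a b"
        using less.IH[of "x - s"] False by auto
      then obtain a' b' where "s + lin a b = lin a' b'" "b' < m" "len_ge e q (Suc 0) a' b'"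
        using len_ge_add_generator[OF s(1)] by blast
      moreover have "s + lin a b = x" using ab(1) s(2) by linarith
      moreover have "len_ge e q 0 a' b'" using calculation(3) by (auto simp: len_ge_def)
      ultimately show ?thesis by metis
    qed
  qed
next
  case (Suc n)
  then obtain s y where s: "s \<in> S" "y \<in> long_sums S n" "x = s + y" by auto
  then show ?case using Suc.IH[of y] len_ge_add_generator[OF s(1)] by blast
qed

lemma add_multiple_in_long_sums:
  assumes "s \<in> S" "y \<in> long_sums S n"
  shows "k * s + y \<in> long_sums S (k + n)"
proof (induction k)
  case (Suc k)
  have "Suc k * s + y = s + (k * s + y)" by simp
  then show ?case using long_sums_SucI[OF assms(1) Suc] by (simp add: add.assoc del: long_sums.simps)
qed (use assms in simp)

lemma long_sums_antimono: "k \<le> n \<Longrightarrow> long_sums S n \<subseteq> long_sums S k"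
  by (rule lift_Suc_antimono_le) (use long_sums_Suc_subset[OF finite_S] in auto)

text \<open>When \<open>b > a\<close>, the long generator is chosen to contribute as much of \<open>b\<close> as possible, so that
  the rest lies in the range covered by \<open>m\<close> and \<open>m + d\<close> alone.\<close>

lemma len_ge_imp_long_sums:
  assumes "len_ge e q n a b"
  shows "lin a b \<in> long_sums S n"
proof -
  have zero: "0 \<in> long_sums S 0" by (simp add: generated_semigroup_0)
  have mS: "m \<in> S" "m + d \<in> S" by (auto simp: S)
  have short: "(u - v) * m + (v * (m + d) + y) \<in> long_sums S (u + k)"
    if "v \<le> u" "y \<in> long_sums S k" for u v y k
    using add_multiple_in_long_sums[OF mS(1) add_multiple_in_long_sums[OF mS(2) that(2), of v],
        of "u - v"] that(1) by simp
  have expand: "(u - v) * m + v * (m + d) = lin u v" if "v \<le> u" for u v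
  proof -
    obtain w where "u = v + w" using \<open>v \<le> u\<close> le_Suc_ex by blast
    then show ?thesis by (simp add: algebra_simps)
  qed
  show ?thesis
  proof (cases "b \<le> a")
    case True
    then have "lin a b \<in> long_sums S a"
      using short[OF True zero] expand[OF True] by simp
    moreover have "n \<le> a" using assms by (auto simp: len_ge_def)
    ultimately show ?thesis using long_sums_antimono by blast
  next
    case False
    then have ab: "q + 1 \<le> a" "b + 2 \<le> a + e" "n + q \<le> a" "a < b"
      using assms by (auto simp: len_ge_def)
    define t where "t = min b (q + e - 1)"
    define s where "s = lin (q + 1) t"
    have "t = q + (t - q)" "2 \<le> t - q" "t - q \<le> e - 1"
      using ab e by (auto simp: t_def)
    then have "s \<in> S"
      unfolding s_def S by (auto intro!: exI[of _ "t - q"])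
    then have s: "s \<in> long_sums S 1"
      using long_sums_SucI[OF _ zero, of s] by simp
    have le: "b - t \<le> a - (q + 1)" using ab e by (auto simp: t_def)
    have "lin (a - (q + 1)) (b - t) + s \<in> long_sums S (a - (q + 1) + 1)"
      using short[OF le s] unfolding add.assoc[symmetric] expand[OF le] .
    moreover have "lin (a - (q + 1)) (b - t) + s = lin a b"
    proof -
      have "a = (a - (q + 1)) + (q + 1)" "b = (b - t) + t"
        using ab by (auto simp: t_def)
      then show ?thesis unfolding s_def
        by (metis add.assoc add.commute add.left_commute distrib_right)
    qed
    moreover have "n \<le> a - (q + 1) + 1" using ab by simp
    ultimately show ?thesis using long_sums_antimono by (metis subsetD)
  qed
qed

lemma long_sums_iff: "b < m \<Longrightarrow> lin a b \<in> long_sums S n \<longleftrightarrow> len_ge e q n a b"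
  using long_sums_imp_len_ge[of "lin a b" n] len_ge_imp_long_sums coordinates_unique[OF coprime]
  by blast

lemma card_long_sums_diff:
  "card (long_sums S n - long_sums S (Suc n)) = card (len_set e q n)"
proof -
  have "inj_on (\<lambda>(a, b). lin a b) (len_set e q n)"
    using coordinates_unique[OF coprime] by (auto simp: inj_on_def len_set_def m)
  moreover have "(\<lambda>(a, b). lin a b) ` len_set e q n = long_sums S n - long_sums S (Suc n)"
  proof (intro equalityI subsetI)
    fix x assume "x \<in> (\<lambda>(a, b). lin a b) ` len_set e q n"
    then show "x \<in> long_sums S n - long_sums S (Suc n)"
      using long_sums_iff by (auto simp: len_set_def m simp del: long_sums.simps)
  next
    fix x assume x: "x \<in> long_sums S n - long_sums S (Suc n)"
    then obtain a b where "x = lin a b" "b < m" "len_ge e q n a b"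
      using long_sums_imp_len_ge by blast
    with x show "x \<in> (\<lambda>(a, b). lin a b) ` len_set e q n"
      using long_sums_iff[of b a "Suc n"]
      by (intro image_eqI[of _ _ "(a, b)"]) (auto simp: len_set_def m simp del: long_sums.simps)
  qed
  ultimately show ?thesis by (metis card_image)
qed

end

theorem theorem3p6:
  fixes e q d m :: nat and S :: "nat set"
  assumes "e \<ge> 4" and "q \<ge> 1" and "d \<ge> 1"
    and "m = e + 2 * q + 1"
    and "gcd m d = 1"
    and "S = {m, m + d} \<union> {(q + 1) * m + (q + i) * d | i. 2 \<le> i \<and> i \<le> e - 1}"
  shows "\<forall>n. hilbert_function TYPE('k::field) S n \<le> hilbert_function TYPE('k) S (n + 1)"
proof -
  interpret long_generator_semigroup e q d m S
    by unfold_locales (use assms in \<open>auto simp: coprime_iff_gcd_eq_1\<close>)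
  have "hilbert_function TYPE('k) S n = card (len_set e q n)" for n
    unfolding hilbert_function_eq_card[OF finite_S zero_notin_S] by (rule card_long_sums_diff)
  then show ?thesis
    using card_len_set_mono[OF assms(2)] by simp
qed

end
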